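(* For every $n\geq 2$, $\kappa^s(BH_n;C_4)=n$.
   Context: The $n$-dimensional balanced hypercube $BH_n$ is the graph with vertex set $\{0,1,2,3\}^n$, vertices written $(a_0,a_1,\dots,a_{n-1})$, in which $(a_0,\dots,a_{n-1})$ is adjacent exactly to the $2n$ vertices $((a_0\pm 1)\bmod 4,a_1,\dots,a_{n-1})$ and, for each $1\le i\le n-1$, $((a_0\pm1)\bmod 4,a_1,\dots,a_{i-1},(a_i+(-1)^{a_0})\bmod 4,a_{i+1},\dots,a_{n-1})$. For a connected graph $G$ and a set $F$ of connected subgraphs of $G$, let $V(F)$ be the union of their vertex sets; $F$ is a subgraph-cut if $G-V(F)$ is disconnected or trivial. For a connected subgraph $H$ of $G$, an $H$-substructure-cut is a subgraph-cut each of whose elements is isomorphic to a connected subgraph of $H$, and $\kappa^s(G;H)$ is the minimum cardinality of an $H$-substructure-cut. $C_4$ is the cycle on four vertices. *)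

theory Defs
  imports "Graph_Theory.Pair_Digraph" "Graph_Theory.Digraph_Isomorphism"
begin

text \<open>
  Undirected graphs are symmetric digraphs. Both orientations of an edge are arcs, so a subgraph
  of an undirected graph has to be required to be symmetric itself. \<open>Digraph_Component.connected\<close>
  requires a nonempty vertex set.
\<close>

definition connected_subgraph :: "'a pair_pre_digraph \<Rightarrow> 'a pair_pre_digraph \<Rightarrow> bool" where
  "connected_subgraph H G \<longleftrightarrow>
     subgraph (with_proj H) (with_proj G) \<and> symmetric (with_proj H) \<and>
     Digraph_Component.connected (with_proj H)"

definition delete_verts :: "'a pair_pre_digraph \<Rightarrow> 'a set \<Rightarrow> ('a, 'a \<times> 'a) pre_digraph" where
  "delete_verts G S = with_proj G \<restriction> (pverts G - S)"

definition trivial_graph :: "('a, 'b) pre_digraph \<Rightarrow> bool" where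
  "trivial_graph G \<longleftrightarrow> card (verts G) = 1"

definition subgraph_cut :: "'a pair_pre_digraph \<Rightarrow> 'a pair_pre_digraph set \<Rightarrow> bool" where
  "subgraph_cut G F \<longleftrightarrow>
     (\<forall>S\<in>F. connected_subgraph S G) \<and>
     (let R = delete_verts G (\<Union>S\<in>F. pverts S)
      in \<not> Digraph_Component.connected R \<or> trivial_graph R)"

text \<open>
  As only isomorphism with subgraphs of \<open>H\<close> matters, \<open>H\<close> may live on a vertex type of its own.
\<close>

definition substructure_cut ::
    "'a pair_pre_digraph \<Rightarrow> 'b pair_pre_digraph \<Rightarrow> 'a pair_pre_digraph set \<Rightarrow> bool" where
  "substructure_cut G H F \<longleftrightarrow>
     subgraph_cut G F \<and>
     (\<forall>S\<in>F. \<exists>T. connected_subgraph T H \<and> digraph_iso (with_proj S) (with_proj T))"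

definition substructure_connectivity ::
    "'a pair_pre_digraph \<Rightarrow> 'b pair_pre_digraph \<Rightarrow> nat" (\<open>\<kappa>\<^sup>s\<close>) where
  "\<kappa>\<^sup>s G H = (LEAST k. \<exists>F. finite F \<and> substructure_cut G H F \<and> card F = k)"

definition cycle_graph :: "nat \<Rightarrow> nat pair_pre_digraph" where
  "cycle_graph k =
     \<lparr> pverts = {..<k},
       parcs = {(i, j). i < k \<and> j < k \<and> (j = Suc i mod k \<or> i = Suc j mod k)} \<rparr>"

definition BH_verts :: "nat \<Rightarrow> int list set" where
  "BH_verts n = {a. length a = n \<and> set a \<subseteq> {0, 1, 2, 3}}"

definition BH_neighbours :: "nat \<Rightarrow> int list \<Rightarrow> int list set" where
  "BH_neighbours n a =
     {a[0 := (a ! 0 + s) mod 4] | s. s \<in> {1, -1}} \<union>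
     {a[0 := (a ! 0 + s) mod 4, i := (a ! i + (-1) ^ nat (a ! 0)) mod 4] | s i.
        s \<in> {1, -1} \<and> 1 \<le> i \<and> i \<le> n - 1}"

definition BH :: "nat \<Rightarrow> int list pair_pre_digraph" where
  "BH n = \<lparr> pverts = BH_verts n, parcs = {(a, b). a \<in> BH_verts n \<and> b \<in> BH_neighbours n a} \<rparr>"

end

theory Submission
  imports Defs
begin

text \<open>
  The vertices \<open>(a, x)\<close> and \<open>(a + 2, x)\<close> of \<open>BH (k + 1)\<close> have the same neighbours. Identifying these
  twins leaves a bipartite graph \<open>Q\<close> with two copies (even and odd \<open>a\<close>) of \<open>\<int>\<^sub>4\<^sup>k\<close>, in which the even
  class \<open>x\<close> is joined to the odd classes \<open>x\<close> and \<open>x + e\<^sub>i\<close>; \<open>Q\<close> has no 4-cycle.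

  Upper bound: the \<open>k + 1\<close> paths \<open>(1, x), (2, x), (3, x)\<close>, with \<open>x\<close> ranging over \<open>0\<close> and the \<open>e\<^sub>i\<close>, cover
  all neighbours of the zero vertex but not the zero vertex itself.

  Lower bound: a connected subgraph of the 4-cycle has at most two even and two odd vertices, so
  \<open>k\<close> of them swallow at most \<open>k\<close> even and \<open>k\<close> odd classes completely. If nonempty sets \<open>X\<close> of even
  and \<open>Z\<close> of odd classes span no edge, then \<open>|X| + |Z| + k \<le> 4\<^sup>k\<close>, with equality only if one of them
  is a singleton. Applied to both pairs of opposite parts of the two sides of a separation, this
  forces equality everywhere, and one of the sides is a single edge of \<open>Q\<close>. The deleted classes are
  then exactly the other neighbours of its two ends, and as an edge between two of them would close
  a 4-cycle in \<open>Q\<close>, no removed subgraph could have an edge.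
\<close>

subsection \<open>Connectivity and crossing arcs\<close>

text \<open>\<open>connected\<close> means reachability in the symmetric closure. A walk that leaves
  \<open>A\<close> uses an arc across its boundary; conversely, the set of vertices reachable from
  \<open>u\<close> has no crossing arc. In this form cuts can be handled without walks.\<close>

lemma connected_iff_crossing_arc:
  assumes "wf_digraph G"
  shows "Digraph_Component.connected G \<longleftrightarrow> verts G \<noteq> {} \<and>
    (\<forall>A. A \<noteq> {} \<and> A \<subset> verts G \<longrightarrow> (\<exists>e\<in>arcs G. (tail G e \<in> A) \<noteq> (head G e \<in> A)))"
    (is "_ \<longleftrightarrow> _ \<and> ?cross")
proof -
  interpret wf_digraph G by fact
  interpret S: pair_wf_digraph "mk_symmetric G" ..
  show ?thesis
  proof (intro iffI conjI)
    assume "Digraph_Component.connected G"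
    then have con: "strongly_connected (mk_symmetric G)" by (simp add: connected_def)
    then show "verts G \<noteq> {}" by (simp add: strongly_connected_def)
    show ?cross
    proof (intro allI impI, elim conjE)
      fix A assume A: "A \<noteq> {}" "A \<subset> verts G"
      then obtain u v where uv: "u \<in> A" "v \<in> verts G" "v \<notin> A" by blast
      then have "u \<rightarrow>\<^sup>*\<^bsub>mk_symmetric G\<^esub> v"
        using con A by (auto simp: strongly_connected_def)
      then have "v \<in> A \<or> (\<exists>e\<in>arcs G. (tail G e \<in> A) \<noteq> (head G e \<in> A))"
        unfolding reachable_def
        by (induction rule: rtrancl_on_induct) (use uv in \<open>auto simp: parcs_mk_symmetric\<close>)
      with uv show "\<exists>e\<in>arcs G. (tail G e \<in> A) \<noteq> (head G e \<in> A)" by blast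
    qed
  next
    assume *: "verts G \<noteq> {} \<and> ?cross"
    have "u \<rightarrow>\<^sup>*\<^bsub>mk_symmetric G\<^esub> v" if uv: "u \<in> verts G" "v \<in> verts G" for u v
    proof (rule ccontr)
      assume nr: "\<not> u \<rightarrow>\<^sup>*\<^bsub>mk_symmetric G\<^esub> v"
      define A where "A = {w \<in> verts G. u \<rightarrow>\<^sup>*\<^bsub>mk_symmetric G\<^esub> w}"
      have "u \<in> A" "v \<notin> A" "A \<subseteq> verts G" using uv nr by (auto simp: A_def)
      then obtain e where e: "e \<in> arcs G" "(tail G e \<in> A) \<noteq> (head G e \<in> A)"
        using * uv by blast
      then have "(tail G e, head G e) \<in> parcs (mk_symmetric G)" "(head G e, tail G e) \<in> parcs (mk_symmetric G)"
        by (auto simp: parcs_mk_symmetric)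
      then show False using e unfolding A_def by (auto intro: S.reachable_adj_trans)
    qed
    then show "Digraph_Component.connected G"
      using * by (auto simp: connected_def strongly_connected_def)
  qed
qed

lemma delete_verts_simps:
  "verts (delete_verts G W) = pverts G - W"
  "arcs (delete_verts G W) = {e \<in> parcs G. fst e \<in> pverts G - W \<and> snd e \<in> pverts G - W}"
  "tail (delete_verts G W) = fst" "head (delete_verts G W) = snd"
  by (auto simp: delete_verts_def induce_subgraph_def)

lemma wf_delete_verts: "wf_digraph (delete_verts G W)"
  by unfold_locales (auto simp: delete_verts_simps)

subsection \<open>Isoperimetry in the twin quotient\<close>

text \<open>
  As updating a list beyond its end does nothing, index \<open>i = k\<close> is the identity on lists of length
  \<open>k\<close>. Hence \<open>bump i x\<close> for \<open>i \<le> k\<close> runs through all odd neighbour classes of the even class \<open>x\<close>.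
\<close>

definition bump :: "nat \<Rightarrow> int list \<Rightarrow> int list" where
  "bump i x = x[i := (x ! i + 1) mod 4]"

definition unbump :: "nat \<Rightarrow> int list \<Rightarrow> int list" where
  "unbump i x = x[i := (x ! i - 1) mod 4]"

text \<open>In terms of \<open>Q\<close>: \<open>X\<close> holds even and \<open>Z\<close> odd
  classes, with no edge between them. The index \<open>k\<close> makes \<open>X\<close> and
  \<open>Z\<close> disjoint as sets of lists.\<close>

definition separated :: "nat \<Rightarrow> int list set \<Rightarrow> int list set \<Rightarrow> bool" where
  "separated k X Z \<longleftrightarrow> X \<subseteq> BH_verts k \<and> Z \<subseteq> BH_verts k \<and> (\<forall>x\<in>X. \<forall>i\<le>k. bump i x \<notin> Z)"

lemma bump_in_BH_verts: "x \<in> BH_verts k \<Longrightarrow> bump i x \<in> BH_verts k"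
proof -
  assume x: "x \<in> BH_verts k"
  have "(x ! i + 1) mod 4 \<in> {0, 1, 2, 3::int}" by auto
  then show ?thesis
    using x set_update_subset_insert[of x i "(x ! i + 1) mod 4"] by (auto simp: BH_verts_def bump_def)
qed

section \<open>Counting by slices along the first coordinate\<close>

lemma BH_verts_Suc: "BH_verts (Suc k) = (\<lambda>(j, x). j # x) ` ({0, 1, 2, 3} \<times> BH_verts k)"
  by (auto simp: BH_verts_def length_Suc_conv image_iff)

lemma BH_verts_0: "BH_verts 0 = {[]}"
  by (auto simp: BH_verts_def)

lemma Cons_in_BH_verts: "j # x \<in> BH_verts (Suc k) \<longleftrightarrow> j \<in> {0, 1, 2, 3} \<and> x \<in> BH_verts k"
  by (auto simp: BH_verts_def)

lemma finite_BH_verts [simp]: "finite (BH_verts k)"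
  by (induction k) (auto simp: BH_verts_0 BH_verts_Suc)

lemma card_BH_verts: "card (BH_verts k) = 4 ^ k"
proof (induction k)
  case (Suc k)
  have "inj_on (\<lambda>(j::int, x). j # x) ({0, 1, 2, 3} \<times> BH_verts k)" by (auto simp: inj_on_def)
  then show ?case by (simp add: BH_verts_Suc card_image Suc)
qed (simp add: BH_verts_0)

lemma card_eq_sum_slices:
  assumes "X \<subseteq> BH_verts (Suc k)"
  shows "card X = card {x. 0 # x \<in> X} + card {x. 1 # x \<in> X} + card {x. 2 # x \<in> X} + card {x. 3 # x \<in> X}"
proof -
  have fin: "finite {x. j # x \<in> X}" for j
    by (rule finite_subset[of _ "BH_verts k"]) (use assms in \<open>auto simp: Cons_in_BH_verts\<close>)
  have "X = (\<lambda>(j, x). j # x) ` (SIGMA j:{0, 1, 2, 3}. {x. j # x \<in> X})"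
    using assms by (force simp: BH_verts_Suc image_iff)
  moreover have "inj_on (\<lambda>(j, x). j # x) (SIGMA j:{0, 1, 2, 3}. {x. j # x \<in> X})"
    by (auto simp: inj_on_def)
  ultimately have "card X = card (SIGMA j:{0, 1, 2, 3}. {x. j # x \<in> X})"
    by (metis card_image)
  also have "\<dots> = (\<Sum>j\<in>{0,1,2,3}. card {x. j # x \<in> X})"
    using fin by (subst card_SigmaI) auto
  finally show ?thesis by simp
qed

text \<open>
  In the next two lemmas \<open>x\<^sub>j\<close> and \<open>z\<^sub>j\<close> are the sizes of the slices of the even and of the odd set with
  first coordinate \<open>j\<close>. Bumping that coordinate bounds \<open>x\<^sub>j + z\<^sub>j\<^sub>+\<^sub>1\<close>, bumping the others bounds \<open>x\<^sub>j + z\<^sub>j\<close>.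
\<close>

lemma slice_arith_zero:
  fixes x0 x1 x2 x3 z0 z1 z2 z3 :: nat
  assumes "x0 = 0 \<or> z0 = 0" "x1 = 0 \<or> z1 = 0" "x2 = 0 \<or> z2 = 0" "x3 = 0 \<or> z3 = 0"
    and "x0 + z1 \<le> 1" "x1 + z2 \<le> 1" "x2 + z3 \<le> 1" "x3 + z0 \<le> 1"
    and "x0 + x1 + x2 + x3 > 0" "z0 + z1 + z2 + z3 > 0"
  shows "x0 + x1 + x2 + x3 + (z0 + z1 + z2 + z3) \<le> 3"
  using assms(1-4) by (elim disjE; use assms(5-) in linarith)


lemma slice_arith:
  fixes x0 x1 x2 x3 z0 z1 z2 z3 k N :: nat
  assumes "x0 > 0 \<Longrightarrow> z0 > 0 \<Longrightarrow> x0 + z0 + k \<le> N" "x1 > 0 \<Longrightarrow> z1 > 0 \<Longrightarrow> x1 + z1 + k \<le> N"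
    "x2 > 0 \<Longrightarrow> z2 > 0 \<Longrightarrow> x2 + z2 + k \<le> N" "x3 > 0 \<Longrightarrow> z3 > 0 \<Longrightarrow> x3 + z3 + k \<le> N"
    and shift: "x0 + z1 \<le> N" "x1 + z2 \<le> N" "x2 + z3 \<le> N" "x3 + z0 \<le> N"
    and nz: "x0 + x1 + x2 + x3 > 0" "z0 + z1 + z2 + z3 > 0" and k: "k \<ge> 1" "k + 2 \<le> N"
  shows "x0 + x1 + x2 + x3 + (z0 + z1 + z2 + z3) + k + 1 \<le> 4 * N"
    "x0 + x1 + x2 + x3 \<ge> 2 \<Longrightarrow> z0 + z1 + z2 + z3 \<ge> 2 \<Longrightarrow>
      x0 + x1 + x2 + x3 + (z0 + z1 + z2 + z3) + k + 2 \<le> 4 * N"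
proof -
  \<comment> \<open>Sorting each level by which of its two slices is empty turns the conditional
    bounds into linear ones; every combination of the four levels is then linear arithmetic.\<close>
  have split: "x0 = 0 \<or> x0 \<ge> 1 \<and> z0 = 0 \<or> x0 \<ge> 1 \<and> z0 \<ge> 1 \<and> x0 + z0 + k \<le> N"
    "x1 = 0 \<or> x1 \<ge> 1 \<and> z1 = 0 \<or> x1 \<ge> 1 \<and> z1 \<ge> 1 \<and> x1 + z1 + k \<le> N"
    "x2 = 0 \<or> x2 \<ge> 1 \<and> z2 = 0 \<or> x2 \<ge> 1 \<and> z2 \<ge> 1 \<and> x2 + z2 + k \<le> N"
    "x3 = 0 \<or> x3 \<ge> 1 \<and> z3 = 0 \<or> x3 \<ge> 1 \<and> z3 \<ge> 1 \<and> x3 + z3 + k \<le> N"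
    using assms(1-4) by linarith+
  show "x0 + x1 + x2 + x3 + (z0 + z1 + z2 + z3) + k + 1 \<le> 4 * N"
    using split by (elim disjE conjE; use shift nz k in linarith)
  show "x0 + x1 + x2 + x3 + (z0 + z1 + z2 + z3) + k + 2 \<le> 4 * N"
    if "x0 + x1 + x2 + x3 \<ge> 2" "z0 + z1 + z2 + z3 \<ge> 2"
    using split by (elim disjE conjE; use shift that k in linarith)
qed

lemma card_add_le_of_disjoint:
  assumes "A \<subseteq> BH_verts k" "B \<subseteq> BH_verts k" "A \<inter> B = {}"
  shows "card A + card B \<le> 4 ^ k"
proof -
  have "finite A" "finite B" using assms finite_subset[OF _ finite_BH_verts] by blast+
  then have "card A + card B = card (A \<union> B)" using assms by (simp add: card_Un_disjoint)
  also have "\<dots> \<le> 4 ^ k" using assms card_mono[of "BH_verts k" "A \<union> B"] by (simp add: card_BH_verts)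
  finally show ?thesis .
qed

lemma add_two_le_four_power: "k \<ge> 1 \<Longrightarrow> k + 2 \<le> (4::nat) ^ k"
  by (induction k rule: dec_induct) auto

text \<open>Isoperimetry in \<open>Q\<close> by induction on the dimension. Slices at the same level
  are again separated, slices at consecutive levels are disjoint, and \<open>slice_arith\<close>
  adds up these bounds. The plain bound for \<open>k\<close> yields both bounds for
  \<open>Suc k\<close>.\<close>

lemma separated_card:
  assumes "separated k X Z" "X \<noteq> {}" "Z \<noteq> {}"
  shows "card X + card Z + k \<le> 4 ^ k \<and>
    (2 \<le> card X \<longrightarrow> 2 \<le> card Z \<longrightarrow> card X + card Z + k + 1 \<le> 4 ^ k)"
  using assms
proof (induction k arbitrary: X Z)
  case 0
  then have "X = {[]}" "Z = {[]}" by (auto simp: separated_def BH_verts_0)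
  \<comment> \<open>Vacuous: the index \<open>0 = k\<close> joins the only even class to the only
    odd class.\<close>
  with 0 show ?case by (auto simp: separated_def bump_def)
next
  case (Suc k)
  define sl where "sl j Y = {x. j # x \<in> Y}" for j :: int and Y
  have sub: "X \<subseteq> BH_verts (Suc k)" "Z \<subseteq> BH_verts (Suc k)"
    and nb: "\<And>x i. x \<in> X \<Longrightarrow> i \<le> Suc k \<Longrightarrow> bump i x \<notin> Z"
    using Suc.prems by (auto simp: separated_def)
  have sl_sub: "sl j X \<subseteq> BH_verts k" "sl j Z \<subseteq> BH_verts k" for j
    using sub by (auto simp: sl_def Cons_in_BH_verts dest!: subsetD)
  have cards: "card X = card (sl 0 X) + card (sl 1 X) + card (sl 2 X) + card (sl 3 X)"
    "card Z = card (sl 0 Z) + card (sl 1 Z) + card (sl 2 Z) + card (sl 3 Z)"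
    using card_eq_sum_slices[OF sub(1)] card_eq_sum_slices[OF sub(2)] by (simp_all add: sl_def)
  have pos: "card X > 0" "card Z > 0"
    using Suc.prems sub by (auto simp: card_gt_0_iff intro: finite_subset)
  have sep: "separated k (sl j X) (sl j Z)" for j
    unfolding separated_def
  proof (intro conjI ballI allI impI sl_sub)
    fix x i assume "x \<in> sl j X" "i \<le> k"
    \<comment> \<open>The head shifts indices by one, so the identity index \<open>k\<close> becomes
      the identity index \<open>Suc k\<close>.\<close>
    then show "bump i x \<notin> sl j Z" using nb[of "j # x" "Suc i"] by (simp add: sl_def bump_def)
  qed
  have level: "card (sl j X) + card (sl j Z) + k \<le> 4 ^ k" if "card (sl j X) > 0" "card (sl j Z) > 0" for j
    using Suc.IH[OF sep, of j] that by (auto simp: card_gt_0_iff)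
  have shift: "card (sl j X) + card (sl ((j + 1) mod 4) Z) \<le> 4 ^ k" for j
  proof (rule card_add_le_of_disjoint[OF sl_sub])
    show "sl j X \<inter> sl ((j + 1) mod 4) Z = {}"
      using nb[of "j # _" 0] by (auto simp: sl_def bump_def)
  qed
  note shifts = shift[of 0, simplified] shift[of 1, simplified] shift[of 2, simplified] shift[of 3, simplified]
  show ?case
  proof (cases "k = 0")
    case True
    \<comment> \<open>Here \<open>4 ^ k = 1\<close>, too small for \<open>slice_arith\<close>;
      instead the level bound says that one of the two slices is empty.\<close>
    have "card (sl j X) = 0 \<or> card (sl j Z) = 0" for j
      using level[of j] True by (cases "card (sl j X) = 0"; cases "card (sl j Z) = 0") simp_all
    then have "card X + card Z \<le> 3"
      unfolding cards using shifts True pos[unfolded cards]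
      by (intro slice_arith_zero) (simp_all only: power_0)
    with True show ?thesis by auto
  next
    case False
    then have k: "k \<ge> 1" "k + 2 \<le> 4 ^ k" using add_two_le_four_power by auto
    show ?thesis
      using slice_arith[OF level level level level shifts _ _ k] pos by (simp add: cards)
  qed
qed

section \<open>Neighbourhoods and 4-cycles in the quotient\<close>

lemma BH_verts_nth: "x \<in> BH_verts k \<Longrightarrow> i < k \<Longrightarrow> 0 \<le> x ! i \<and> x ! i < 4"
  by (induction x arbitrary: k i) (auto simp: BH_verts_def nth_Cons split: nat.split)

lemma unbump_in_BH_verts: "x \<in> BH_verts k \<Longrightarrow> unbump i x \<in> BH_verts k"
proof -
  assume x: "x \<in> BH_verts k"
  have "(x ! i - 1) mod 4 \<in> {0, 1, 2, 3::int}" by auto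
  then show ?thesis
    using x set_update_subset_insert[of x i "(x ! i - 1) mod 4"] by (auto simp: BH_verts_def unbump_def)
qed

text \<open>Lets edges of \<open>Q\<close> be read from the odd end: the neighbours of an odd class
  \<open>y\<close> are the \<open>unbump i y\<close>. Entries are reduced mod 4, so the two shifts
  are inverse; beyond the end both are the identity.\<close>

lemma eq_bump_iff:
  assumes "x \<in> BH_verts k" "y \<in> BH_verts k"
  shows "y = bump i x \<longleftrightarrow> x = unbump i y"
proof (cases "i < k")
  case True
  have "length x = k" "length y = k" using assms by (auto simp: BH_verts_def)
  moreover have "x ! i mod 4 = x ! i" "y ! i mod 4 = y ! i"
    using BH_verts_nth[OF assms(1) True] BH_verts_nth[OF assms(2) True] by simp_all
  ultimately have "unbump i (bump i x) = x" "bump i (unbump i y) = y"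
    using True by (simp_all add: bump_def unbump_def mod_simps)
  then show ?thesis by metis
next
  case False
  then have "bump i x = x" "unbump i y = y"
    using assms by (simp_all add: bump_def unbump_def BH_verts_def list_update_beyond)
  then show ?thesis by metis
qed

text \<open>One formula for every index, the identity index \<open>k\<close> included: reduction mod
  4 leaves unshifted entries as they are.\<close>

lemma nth_bump:
  assumes "x \<in> BH_verts k" "c < k"
  shows "bump i x ! c = (x ! c + of_bool (i = c)) mod 4"
  using assms BH_verts_nth[OF assms] by (auto simp: bump_def BH_verts_def nth_list_update)

lemma nth_unbump:
  assumes "x \<in> BH_verts k" "c < k"
  shows "unbump i x ! c = (x ! c - of_bool (i = c)) mod 4"
  using assms BH_verts_nth[OF assms] by (auto simp: unbump_def BH_verts_def nth_list_update)

lemma inj_on_bump: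
  assumes "x \<in> BH_verts k"
  shows "inj_on (\<lambda>i. bump i x) {..k}"
proof (rule inj_onI, rule ccontr)
  fix i j assume ij: "i \<in> {..k}" "j \<in> {..k}" "bump i x = bump j x" "i \<noteq> j"
  \<comment> \<open>The larger index may be \<open>k\<close>, which is no coordinate. The smaller
    one always is, and exactly one of the two bumps changes it.\<close>
  define c where "c = min i j"
  have c: "c < k" using ij by (auto simp: c_def)
  have "(x ! c + of_bool (i = c)) mod 4 = (x ! c + of_bool (j = c)) mod 4"
    using arg_cong[OF ij(3), of "\<lambda>l. l ! c"] by (simp add: nth_bump[OF assms c])
  moreover have "(i = c) \<noteq> (j = c)" using ij(4) by (auto simp: c_def)
  ultimately show False by (cases "i = c") (simp_all, presburger+)
qed

lemma inj_on_unbump: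
  assumes "x \<in> BH_verts k"
  shows "inj_on (\<lambda>i. unbump i x) {..k}"
proof (rule inj_onI, rule ccontr)
  fix i j assume ij: "i \<in> {..k}" "j \<in> {..k}" "unbump i x = unbump j x" "i \<noteq> j"
  define c where "c = min i j"
  have c: "c < k" using ij by (auto simp: c_def)
  have "(x ! c - of_bool (i = c)) mod 4 = (x ! c - of_bool (j = c)) mod 4"
    using arg_cong[OF ij(3), of "\<lambda>l. l ! c"] by (simp add: nth_unbump[OF assms c])
  moreover have "(i = c) \<noteq> (j = c)" using ij(4) by (auto simp: c_def)
  ultimately show False by (cases "i = c") (simp_all, presburger+)
qed

text \<open>The quotient has no 4-cycle \<open>x, bump s x, a, bump t x\<close>.\<close>

lemma bump_square_degenerate:
  assumes x: "x \<in> BH_verts k" and a: "a \<in> BH_verts k"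
    and "s \<le> k" "t \<le> k" "p \<le> k" "q \<le> k"
    and y: "bump s x = bump p a" and b: "bump t x = bump q a" and "s \<noteq> t"
  shows "s = p"
proof -
  \<comment> \<open>Subtracting the two equations eliminates \<open>x\<close> and \<open>a\<close>:
    modulo 4, \<open>e_s - e_t = e_p - e_q\<close>, where \<open>e_k = 0\<close>.\<close>
  have eq: "(of_bool (s = c) - of_bool (t = c) :: int) mod 4 = (of_bool (p = c) - of_bool (q = c)) mod 4"
    if c: "c < k" for c
  proof -
    have "(x ! c + of_bool (s = c)) mod 4 = (a ! c + of_bool (p = c)) mod 4"
      "(x ! c + of_bool (t = c)) mod 4 = (a ! c + of_bool (q = c)) mod 4"
      using arg_cong[OF y, of "\<lambda>l. l ! c"] arg_cong[OF b, of "\<lambda>l. l ! c"]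
      by (simp_all add: nth_bump[OF x c] nth_bump[OF a c])
    from mod_diff_cong[OF this] show ?thesis by (simp del: of_bool_eq_iff)
  qed
  show ?thesis
  proof (cases "s < k")
    case True
    \<comment> \<open>At coordinate \<open>s\<close> the left side is 1, which forces
      \<open>p = s\<close>.\<close>
    from eq[OF True] \<open>s \<noteq> t\<close> show ?thesis by (auto simp: of_bool_def split: if_splits)
  next
    case False
    \<comment> \<open>Now \<open>s\<close> is the identity index. Coordinate \<open>t\<close> has -1
      on the left, so \<open>q = t\<close>; were \<open>p\<close> a coordinate, the right side there
      would be 1 and the left side 0.\<close>
    with assms have t: "s = k" "t < k" by auto
    have qt: "q = t" "p \<noteq> t" using eq[OF t(2)] \<open>s \<noteq> t\<close> by (auto simp: of_bool_def split: if_splits)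
    have "\<not> p < k" using eq[of p] qt t by (auto simp: of_bool_def split: if_splits)
    with \<open>p \<le> k\<close> t show ?thesis by simp
  qed
qed

text \<open>The \<open>k + 1\<close> neighbours of \<open>x\<close> avoid \<open>Yo\<close>, hence
  fill \<open>insert y Do\<close>, which has no room to spare; likewise those of \<open>y\<close>
  fill \<open>insert x De\<close>. An edge from \<open>a\<close> to \<open>Do\<close> would close
  the 4-cycle \<open>x\<close>, \<open>y\<close>, \<open>a\<close>, \<open>bump i a\<close>.\<close>

lemma single_edge_side:
  assumes V: "Ye \<subseteq> BH_verts k" "Yo \<subseteq> BH_verts k" "De \<subseteq> BH_verts k" "Do \<subseteq> BH_verts k"
    and cover: "insert x (Ye \<union> De) = BH_verts k" "insert y (Yo \<union> Do) = BH_verts k"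
    and sep: "separated k {x} Yo" "separated k Ye {y}"
    and card: "card De = k" "card Do = k"
    and a: "a \<in> De" and i: "i \<le> k"
  shows "bump i a \<notin> Do"
proof
  assume b: "bump i a \<in> Do"
  have x: "x \<in> BH_verts k" and y: "y \<in> BH_verts k" and aV: "a \<in> BH_verts k" using cover V a by blast+
  have fin: "finite De" "finite Do" using V by (auto intro: finite_subset)
  have eqI: "A = insert z D \<and> z \<notin> D" if "A \<subseteq> insert z D" "card A = Suc k" "card D = k" "finite D"
    for A D :: "int list set" and z
  proof -
    have "card (insert z D) \<le> card A" using that by (simp add: card_insert_if)
    then have "A = insert z D" using that by (intro card_seteq) auto
    then show ?thesis using that by (auto simp: insert_absorb)
  qed
  have "(\<lambda>i. bump i x) ` {..k} = insert y Do \<and> y \<notin> Do"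
  proof (rule eqI[OF _ _ card(2) fin(2)])
    show "(\<lambda>i. bump i x) ` {..k} \<subseteq> insert y Do"
      using sep(1) cover(2) bump_in_BH_verts[OF x] unfolding separated_def by blast
    show "card ((\<lambda>i. bump i x) ` {..k}) = Suc k" by (simp add: card_image inj_on_bump[OF x])
  qed
  moreover have "(\<lambda>i. unbump i y) ` {..k} = insert x De \<and> x \<notin> De"
  proof (rule eqI[OF _ _ card(1) fin(1)])
    show "card ((\<lambda>i. unbump i y) ` {..k}) = Suc k" by (simp add: card_image inj_on_unbump[OF y])
    show "(\<lambda>i. unbump i y) ` {..k} \<subseteq> insert x De"
    proof
      fix z assume "z \<in> (\<lambda>i. unbump i y) ` {..k}"
      then obtain i where "i \<le> k" "z = unbump i y" by auto
      with y have z: "z \<in> BH_verts k" by (simp add: unbump_in_BH_verts)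
      have "y = bump i z" using \<open>z = unbump i y\<close> eq_bump_iff[OF z y] by simp
      with \<open>i \<le> k\<close> sep(2) have "z \<notin> Ye" by (auto simp: separated_def)
      with z cover(1) show "z \<in> insert x De" by blast
    qed
  qed
  ultimately have "y \<in> (\<lambda>i. bump i x) ` {..k}" "bump i a \<in> (\<lambda>i. bump i x) ` {..k}"
    "a \<in> (\<lambda>i. unbump i y) ` {..k}" "x \<notin> De" "y \<notin> Do"
    using a b by auto
  then obtain s t p where *: "s \<le> k" "y = bump s x" "t \<le> k" "bump i a = bump t x"
    "p \<le> k" "a = unbump p y" "x \<notin> De" "y \<notin> Do"
    by auto
  then have "y = bump p a" using eq_bump_iff[OF aV y] by simp
  \<comment> \<open>Equal indices would give \<open>y = bump i a\<close>, an element of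
    \<open>Do\<close>. So the cycle is genuine at \<open>x\<close>, and
    \<open>bump_square_degenerate\<close> forces \<open>a = x\<close>, although \<open>x\<close> is
    not in \<open>De\<close>.\<close>
  have "s \<noteq> t" using * b by metis
  then have "s = p"
    using bump_square_degenerate[OF x aV \<open>s \<le> k\<close> \<open>t \<le> k\<close> \<open>p \<le> k\<close> i] * \<open>y = bump p a\<close> by metis
  then have "x = a" using eq_bump_iff[OF aV y] eq_bump_iff[OF x y] * by metis
  with * a show False by simp
qed

text \<open>\<open>Xe\<close>, \<open>Xo\<close> are the classes meeting one side and
  \<open>Ye\<close>, \<open>Yo\<close> those meeting the other; they may overlap, as twins can lie
  on different sides. Covering gives the four sizes a sum of at least
  \<open>2 * 4 ^ k - 2 * k\<close>, and the two isoperimetric bounds give at most that, so all are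
  equalities.\<close>

lemma separation_tight:
  assumes V: "De \<subseteq> BH_verts k" "Do \<subseteq> BH_verts k"
    and cover: "Xe \<union> Ye \<union> De = BH_verts k" "Xo \<union> Yo \<union> Do = BH_verts k"
    and sep: "separated k Xe Yo" "separated k Ye Xo"
    and D: "card De \<le> k" "card Do \<le> k"
    and ne: "Xe \<union> Xo \<noteq> {}" "Ye \<union> Yo \<noteq> {}"
  shows "card De = k \<and> card Do = k \<and> (card Xe = 1 \<and> card Xo = 1 \<or> card Ye = 1 \<and> card Yo = 1)"
proof -
  have pk: "k < 4 ^ k" using add_two_le_four_power[of k] by (cases k) auto
  have fin: "finite Xe" "finite Ye" "finite Xo" "finite Yo" "finite De" "finite Do"
    using sep V by (auto simp: separated_def intro: finite_subset)
  have le: "4 ^ k \<le> card Xe + card Ye + card De" "4 ^ k \<le> card Xo + card Yo + card Do"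
    using card_Un_le[of "Xe \<union> Ye" De] card_Un_le[of Xe Ye] card_Un_le[of "Xo \<union> Yo" Do] card_Un_le[of Xo Yo]
    unfolding cover card_BH_verts by linarith+
  have sXY: "card Xe = 0 \<or> card Yo = 0 \<or> card Xe + card Yo + k \<le> 4 ^ k \<and>
      (card Xe \<ge> 2 \<longrightarrow> card Yo \<ge> 2 \<longrightarrow> card Xe + card Yo + k + 1 \<le> 4 ^ k)"
    using separated_card[OF sep(1)] by (metis card.empty)
  have sYX: "card Ye = 0 \<or> card Xo = 0 \<or> card Ye + card Xo + k \<le> 4 ^ k \<and>
      (card Ye \<ge> 2 \<longrightarrow> card Xo \<ge> 2 \<longrightarrow> card Ye + card Xo + k + 1 \<le> 4 ^ k)"
    using separated_card[OF sep(2)] by (metis card.empty)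
  have ne': "card Xe > 0 \<or> card Xo > 0" "card Ye > 0 \<or> card Yo > 0"
    using ne fin by (auto simp: card_gt_0_iff)
  \<comment> \<open>If \<open>Xe\<close> were empty, \<open>Xo\<close> would not be, and
    \<open>Ye\<close> would have at least \<open>4 ^ k - k\<close> elements, one more than its
    separation from \<open>Xo\<close> allows. The other three sets are treated alike.\<close>
  have "card Xe > 0" using ne' sXY sYX le D pk by linarith
  moreover have "card Xo > 0" using ne' sXY sYX le D pk by linarith
  moreover have "card Ye > 0" using ne' sXY sYX le D pk by linarith
  moreover have "card Yo > 0" using ne' sXY sYX le D pk by linarith
  ultimately have "card Xe + card Yo + k \<le> 4 ^ k" "card Ye + card Xo + k \<le> 4 ^ k"
    and small: "card Xe = 1 \<or> card Yo = 1 \<or> card Xe + card Yo + k + 1 \<le> 4 ^ k"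
    "card Ye = 1 \<or> card Xo = 1 \<or> card Ye + card Xo + k + 1 \<le> 4 ^ k"
    using sXY sYX by linarith+
  then have "card De = k" "card Do = k" "card Xe = card Xo" "card Ye = card Yo"
    "card Xe + card Yo + k = 4 ^ k" "card Ye + card Xo + k = 4 ^ k"
    using le D by linarith+
  with small show ?thesis by auto
qed

subsection \<open>Arcs of the balanced hypercube\<close>

text \<open>Modulo 4, \<open>p + 1\<close> and \<open>p - 1\<close> are all the residues of the
  other parity. This is why \<open>a\<close> and \<open>a + 2\<close> give twins.\<close>

lemma shift_parity_iff:
  assumes "p \<in> {0, 1, 2, 3::int}"
  shows "(\<exists>s\<in>{1, -1}. q = (p + s) mod 4) \<longleftrightarrow> q \<in> {0, 1, 2, 3} \<and> (odd q \<longleftrightarrow> even p)"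
  using assms by auto

text \<open>The sign \<open>(-1) ^ a\<close> bumps from an even vertex and unbumps from an odd one,
  so both orientations of an edge carry the same relation, read from the even end. First coordinates
  matter only through their parity.\<close>

lemma BH_arc_iff:
  "(p # x, q # y) \<in> parcs (BH (Suc k)) \<longleftrightarrow>
     p \<in> {0, 1, 2, 3} \<and> q \<in> {0, 1, 2, 3} \<and> x \<in> BH_verts k \<and> y \<in> BH_verts k \<and>
     (even p \<and> odd q \<and> (\<exists>i\<le>k. y = bump i x) \<or> odd p \<and> even q \<and> (\<exists>i\<le>k. x = bump i y))"
proof (cases "p \<in> {0, 1, 2, 3} \<and> x \<in> BH_verts k")
  case True
  then have p: "p \<in> {0, 1, 2, 3}" and x: "x \<in> BH_verts k" by auto
  have len: "length x = k" using x by (simp add: BH_verts_def)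
  have nbr: "q # y \<in> BH_neighbours (Suc k) (p # x) \<longleftrightarrow>
      (\<exists>s\<in>{1, -1}. q = (p + s) mod 4) \<and> (\<exists>i\<le>k. y = x[i := (x ! i + (-1) ^ nat p) mod 4])" (is "?L \<longleftrightarrow> ?R")
  proof
    assume ?L
    then consider s where "s \<in> {1, -1}" "q # y = (p # x)[0 := ((p # x) ! 0 + s) mod 4]"
      | s i where "s \<in> {1, -1}" "1 \<le> i" "i \<le> Suc k - 1"
        "q # y = (p # x)[0 := ((p # x) ! 0 + s) mod 4, i := ((p # x) ! i + (-1) ^ nat ((p # x) ! 0)) mod 4]"
      unfolding BH_neighbours_def by blast
    then show ?R
    proof cases
      case 1
      \<comment> \<open>Arcs that change only the first coordinate correspond to the identity index
        \<open>k\<close>.\<close>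
      then show ?thesis using len by (auto intro!: exI[of _ k] simp: list_update_beyond)
    next
      case 2
      then obtain i' where "i = Suc i'" by (cases i) auto
      with 2 show ?thesis by (auto intro!: exI[of _ i'])
    qed
  next
    assume ?R
    then obtain s i where si: "s \<in> {1, -1}" "q = (p + s) mod 4" "i \<le> k" "y = x[i := (x ! i + (-1) ^ nat p) mod 4]"
      by blast
    show ?L
    proof (cases "i = k")
      case True
      with si len have "q # y = (p # x)[0 := ((p # x) ! 0 + s) mod 4]" by (simp add: list_update_beyond)
      with si(1) show ?thesis unfolding BH_neighbours_def by blast
    next
      case False
      have "q # y = (p # x)[0 := ((p # x) ! 0 + s) mod 4, Suc i := ((p # x) ! Suc i + (-1) ^ nat ((p # x) ! 0)) mod 4]"
        using si by simp
      moreover have "1 \<le> Suc i" "Suc i \<le> Suc k - 1" using False si by auto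
      ultimately show ?thesis using si(1) unfolding BH_neighbours_def by blast
    qed
  qed
  have upd: "(\<exists>i\<le>k. y = x[i := (x ! i + (-1) ^ nat p) mod 4]) \<longleftrightarrow>
      y \<in> BH_verts k \<and> (\<exists>i\<le>k. if even p then y = bump i x else x = bump i y)"
  proof (cases "even p")
    case True
    then have "(-1::int) ^ nat p = 1" using p by (auto simp: even_nat_iff)
    then show ?thesis using True x bump_in_BH_verts by (auto simp: bump_def)
  next
    case False
    then have *: "(-1::int) ^ nat p = -1" using p by (auto simp: even_nat_iff)
    have "(\<exists>i\<le>k. y = unbump i x) \<longleftrightarrow> y \<in> BH_verts k \<and> (\<exists>i\<le>k. x = bump i y)"
      using x unbump_in_BH_verts eq_bump_iff by metis
    then show ?thesis unfolding * using False by (simp add: unbump_def)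
  qed
  have "(p # x, q # y) \<in> parcs (BH (Suc k)) \<longleftrightarrow> q # y \<in> BH_neighbours (Suc k) (p # x)"
    using True by (simp add: BH_def Cons_in_BH_verts)
  then show ?thesis
    unfolding nbr upd shift_parity_iff[OF p] using p x by (cases "even p") (simp_all only: if_True if_False, blast+)
next
  case False
  then show ?thesis by (auto simp: BH_def Cons_in_BH_verts)
qed

lemma pverts_BH: "pverts (BH n) = BH_verts n"
  by (simp add: BH_def)

lemma BH_verts_SucE:
  assumes "v \<in> BH_verts (Suc k)"
  obtains p x where "v = p # x" "p \<in> {0, 1, 2, 3}" "x \<in> BH_verts k"
  using assms by (auto simp: BH_verts_Suc)

lemma BH_arc_in_verts:
  assumes "(u, v) \<in> parcs (BH (Suc k))"
  shows "u \<in> BH_verts (Suc k)" "v \<in> BH_verts (Suc k)"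
proof -
  show u: "u \<in> BH_verts (Suc k)" using assms by (simp add: BH_def)
  then have "length u = Suc k" by (simp add: BH_verts_def)
  with assms have "length v = Suc k" by (auto simp: BH_def BH_neighbours_def)
  then obtain q y where "v = q # y" by (cases v) auto
  with u assms show "v \<in> BH_verts (Suc k)"
    by (auto elim!: BH_verts_SucE simp: BH_arc_iff Cons_in_BH_verts)
qed

lemma BH_arc_parity: "(u, v) \<in> parcs (BH (Suc k)) \<Longrightarrow> even (hd u) \<longleftrightarrow> odd (hd v)"
  using BH_arc_in_verts[of u v k] by (auto elim!: BH_verts_SucE simp: BH_arc_iff)

lemma BH_arc_sym: "(u, v) \<in> parcs (BH (Suc k)) \<Longrightarrow> (v, u) \<in> parcs (BH (Suc k))"
  using BH_arc_in_verts[of u v k] by (auto elim!: BH_verts_SucE simp: BH_arc_iff)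

lemma wf_BH: "wf_digraph (with_proj (BH (Suc k)))"
  by unfold_locales (auto simp: pverts_BH dest: BH_arc_in_verts)

subsection \<open>Substructures of the 4-cycle\<close>

lemma connected_has_arc:
  assumes "wf_digraph (with_proj S)" "Digraph_Component.connected (with_proj S)"
    "u \<in> pverts S" "v \<in> pverts S" "u \<noteq> v"
  obtains w where "w \<in> pverts S" "w \<noteq> u" "(u, w) \<in> parcs S \<or> (w, u) \<in> parcs S"
proof -
  have "\<forall>A. A \<noteq> {} \<and> A \<subset> pverts S \<longrightarrow> (\<exists>e\<in>parcs S. (fst e \<in> A) \<noteq> (snd e \<in> A))"
    using assms(2) connected_iff_crossing_arc[OF assms(1)] by simp
  moreover have "{u} \<subset> pverts S" using assms(3-) by auto
  ultimately have "\<exists>e\<in>parcs S. (fst e \<in> {u}) \<noteq> (snd e \<in> {u})" by blast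
  then obtain a b where "(a, b) \<in> parcs S" "(a = u) \<noteq> (b = u)" by fastforce
  moreover from this have "a \<in> pverts S" "b \<in> pverts S"
    using assms(1) wf_digraph.wellformed[of "with_proj S" "(a, b)"] by auto
  ultimately show ?thesis using that by metis
qed

text \<open>By connectedness every vertex of \<open>B\<close> has a neighbour outside
  \<open>B\<close>. With three vertices in \<open>B\<close>, exactly one vertex \<open>c\<close> of
  the 4-cycle lies outside the image of \<open>B\<close>, and the vertex opposite \<open>c\<close>
  is not adjacent to it.\<close>

lemma C4_substructure_independent:
  assumes wf: "wf_digraph (with_proj S)" and con: "Digraph_Component.connected (with_proj S)"
    and T: "connected_subgraph T (cycle_graph 4)" and iso: "digraph_iso (with_proj S) (with_proj T)"
    and B: "B \<subseteq> pverts S" "\<And>u v. u \<in> B \<Longrightarrow> v \<in> B \<Longrightarrow> (u, v) \<notin> parcs S"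
  shows "finite (pverts S)" "card B \<le> 2"
proof -
  from iso obtain h where h: "pre_digraph.digraph_isomorphism (with_proj S) h"
    and Th: "with_proj T = app_iso h (with_proj S)" by (auto simp: digraph_iso_def)
  define f where "f = iso_verts h"
  have inj: "inj_on f (pverts S)" using h by (simp add: pre_digraph.digraph_isomorphism_def f_def)
  have TC: "pverts T \<subseteq> {..<4}" "parcs T \<subseteq> parcs (cycle_graph 4)"
    using T by (auto simp: connected_subgraph_def cycle_graph_def dest!: subgraph_imp_subverts elim!: subgraphE)
  have "pverts T = f ` pverts S" using arg_cong[OF Th, of verts] by (simp add: f_def)
  then have f4: "f ` pverts S \<subseteq> {..<4}" using TC by simp
  then show fin: "finite (pverts S)" using inj by (meson finite_imageD finite_lessThan finite_subset)
  have f_arc: "(f u, f v) \<in> parcs (cycle_graph 4)" if "(u, v) \<in> parcs S" for u v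
  proof -
    have "iso_arcs h (u, v) \<in> parcs T" using arg_cong[OF Th, of arcs] that by simp
    moreover have "iso_tail h = fst" "iso_head h = snd"
      using arg_cong[OF Th, of tail] arg_cong[OF Th, of head] by simp_all
    then have "fst (iso_arcs h (u, v)) = f u" "snd (iso_arcs h (u, v)) = f v"
      using h that unfolding pre_digraph.digraph_isomorphism_def f_def by fastforce+
    ultimately show ?thesis using TC(2) by (metis prod.collapse subsetD)
  qed
  show "card B \<le> 2"
  proof (rule ccontr)
    assume "\<not> card B \<le> 2"
    then have B3: "card B \<ge> 3" by simp
    have "card (f ` B) = card B" using inj B(1) by (metis card_image inj_on_subset)
    then have fB: "f ` B \<subseteq> {..<4}" "card (f ` B) \<ge> 3" using f4 B B3 by auto
    have nbr: "\<exists>w \<in> pverts S. f w \<notin> f ` B \<and> ((f b, f w) \<in> parcs (cycle_graph 4) \<or> (f w, f b) \<in> parcs (cycle_graph 4))"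
      if b: "b \<in> B" for b
    proof -
      have "\<exists>v\<in>B. v \<noteq> b"
      proof (rule ccontr)
        assume "\<not> (\<exists>v\<in>B. v \<noteq> b)"
        then have "B \<subseteq> {b}" by blast
        then have "card B \<le> 1" using card_mono[of "{b}" B] by simp
        with B3 show False by simp
      qed
      then obtain v where "v \<in> B" "v \<noteq> b" by blast
      then obtain w where w: "w \<in> pverts S" "(b, w) \<in> parcs S \<or> (w, b) \<in> parcs S"
        using connected_has_arc[OF wf con, of b v] b B(1) by blast
      then have "w \<notin> B" using B(2) b by blast
      then have "f w \<notin> f ` B" using inj w B(1) by (auto simp: inj_on_def)
      with w f_arc show ?thesis by blast
    qed
    have "f ` B \<noteq> {..<4}"
    proof
      assume *: "f ` B = {..<4}"
      then obtain b where "b \<in> B" by (metis image_is_empty lessThan_empty_iff zero_neq_numeral ex_in_conv)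
      from nbr[OF this] f4 * show False by blast
    qed
    then obtain c where c: "c < 4" "c \<notin> f ` B" using fB by blast
    have "f ` B = {..<4} - {c}"
      using fB c by (intro card_seteq) (auto simp: card_Diff_singleton)
    then have "(c + 2) mod 4 \<in> f ` B" using c by (auto simp: mod_if)
    then obtain b where b: "b \<in> B" "f b = (c + 2) mod 4" by auto
    from nbr[OF b(1)] obtain w where "w \<in> pverts S" "f w \<notin> f ` B"
      "(f b, f w) \<in> parcs (cycle_graph 4) \<or> (f w, f b) \<in> parcs (cycle_graph 4)" by blast
    moreover from this f4 \<open>f ` B = {..<4} - {c}\<close> have "f w = c" by blast
    ultimately have "((c + 2) mod 4, c) \<in> parcs (cycle_graph 4) \<or> (c, (c + 2) mod 4) \<in> parcs (cycle_graph 4)"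
      using b(2) by simp
    moreover have "c = 0 \<or> c = 1 \<or> c = 2 \<or> c = 3" using c(1) by linarith
    ultimately show False by (elim disjE) (simp_all add: cycle_graph_def)
  qed
qed

text \<open>The parity of the first coordinate is a proper 2-colouring of \<open>BH (Suc k)\<close>,
  so each parity class is independent.\<close>

lemma C4_substructure_parity_card:
  assumes S: "connected_subgraph S (BH (Suc k))" and T: "connected_subgraph T (cycle_graph 4)"
    and iso: "digraph_iso (with_proj S) (with_proj T)"
  shows "finite (pverts S)" "card {v \<in> pverts S. even (hd v) = b} \<le> 2"
proof -
  have "wf_digraph (with_proj S)" "Digraph_Component.connected (with_proj S)"
    and sub: "parcs S \<subseteq> parcs (BH (Suc k))"
    using S by (auto simp: connected_subgraph_def elim!: subgraphE)
  note ind = C4_substructure_independent[OF this(1,2) T iso, where B = "{v \<in> pverts S. even (hd v) = b}"]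
  have "(u, v) \<notin> parcs S" if "u \<in> {v \<in> pverts S. even (hd v) = b}" "v \<in> {v \<in> pverts S. even (hd v) = b}" for u v
    using that sub BH_arc_parity[of u v k] by auto
  then show "finite (pverts S)" "card {v \<in> pverts S. even (hd v) = b} \<le> 2"
    by (intro ind; blast)+
qed

subsection \<open>Lower bound\<close>

text \<open>\<open>True\<close> stands for even. The class \<open>x\<close> of parity
  \<open>b\<close> consists of \<open>twin_base b # x\<close> and
  \<open>(twin_base b + 2) # x\<close>.\<close>

definition twin_base :: "bool \<Rightarrow> int" where
  "twin_base b = (if b then 0 else 1)"

definition touched :: "bool \<Rightarrow> int list set \<Rightarrow> int list set" where
  "touched b A = {x. twin_base b # x \<in> A \<or> (twin_base b + 2) # x \<in> A}"

definition swallowed :: "bool \<Rightarrow> int list set \<Rightarrow> int list set" where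
  "swallowed b W = {x. twin_base b # x \<in> W \<and> (twin_base b + 2) # x \<in> W}"

text \<open>Each swallowed class contributes two vertices to \<open>W\<close>. If these are all the
  vertices of that parity in \<open>W\<close>, then \<open>W\<close> is a union of whole classes
  there.\<close>

lemma swallowed_card:
  assumes "W \<subseteq> BH_verts (Suc k)"
  shows "2 * card (swallowed b W) \<le> card {v \<in> W. even (hd v) = b}"
    "2 * card (swallowed b W) = card {v \<in> W. even (hd v) = b} \<Longrightarrow>
      v \<in> W \<Longrightarrow> even (hd v) = b \<Longrightarrow> tl v \<in> swallowed b W"
proof -
  define T where "T = (#) (twin_base b) ` swallowed b W \<union> (#) (twin_base b + 2) ` swallowed b W"
  have finW: "finite W" using assms by (rule finite_subset) simp
  have "swallowed b W \<subseteq> BH_verts k" using assms by (auto simp: swallowed_def Cons_in_BH_verts dest!: subsetD)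
  then have fin: "finite (swallowed b W)" by (rule finite_subset) simp
  have "card T = card ((#) (twin_base b) ` swallowed b W) + card ((#) (twin_base b + 2) ` swallowed b W)"
    unfolding T_def using fin by (intro card_Un_disjoint) auto
  then have T: "card T = 2 * card (swallowed b W)" by (simp add: card_image)
  have sub: "T \<subseteq> {v \<in> W. even (hd v) = b}" by (auto simp: T_def swallowed_def twin_base_def)
  show "2 * card (swallowed b W) \<le> card {v \<in> W. even (hd v) = b}"
    using card_mono[OF _ sub] finW T by simp
  assume "2 * card (swallowed b W) = card {v \<in> W. even (hd v) = b}" and v: "v \<in> W" "even (hd v) = b"
  then have "T = {v \<in> W. even (hd v) = b}"
    using T finW sub by (intro card_subset_eq) auto
  then have "v \<in> T" using v by simp
  then show "tl v \<in> swallowed b W" by (auto simp: T_def)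
qed

lemma touched_subset:
  assumes "A \<subseteq> BH_verts (Suc k)"
  shows "touched b A \<subseteq> BH_verts k"
proof -
  have "x \<in> BH_verts k" if "p # x \<in> A" for p x
    using subsetD[OF assms that] by (simp add: Cons_in_BH_verts)
  then show ?thesis by (auto simp: touched_def)
qed

text \<open>An edge of \<open>Q\<close> joins every vertex of the one class to every vertex of the
  other, so it does not matter which twin lies in \<open>A\<close> or \<open>B\<close>.\<close>

lemma separated_touched:
  assumes A: "A \<subseteq> BH_verts (Suc k)" and B: "B \<subseteq> BH_verts (Suc k)"
    and no_arc: "\<And>u v. (u, v) \<in> parcs (BH (Suc k)) \<Longrightarrow> u \<in> A \<Longrightarrow> v \<notin> B"
  shows "separated k (touched True A) (touched False B)"
  unfolding separated_def
proof (intro conjI ballI allI impI)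
  show sub: "touched True A \<subseteq> BH_verts k" "touched False B \<subseteq> BH_verts k"
    using A B by (simp_all add: touched_subset)
  fix x i assume x: "x \<in> touched True A" and i: "i \<le> k"
  then obtain p where p: "p \<in> {0, 2}" "p # x \<in> A" by (auto simp: touched_def twin_base_def)
  show "bump i x \<notin> touched False B"
  proof
    assume "bump i x \<in> touched False B"
    then obtain q where q: "q \<in> {1, 3}" "q # bump i x \<in> B" by (auto simp: touched_def twin_base_def)
    have "x \<in> BH_verts k" using x sub by blast
    then have "(p # x, q # bump i x) \<in> parcs (BH (Suc k))"
      using p q i by (auto simp: BH_arc_iff bump_in_BH_verts)
    with no_arc p q show False by blast
  qed
qed

text \<open>A class that is not swallowed keeps a vertex outside \<open>W\<close>, and that vertex
  lies in \<open>A\<close> or \<open>B\<close>.\<close>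

lemma touched_cover:
  assumes "A \<union> B \<union> W = BH_verts (Suc k)"
  shows "touched b A \<union> touched b B \<union> swallowed b W = BH_verts k"
proof -
  have "x \<in> BH_verts k" if "p # x \<in> A \<union> B \<union> W" for p x
    using that unfolding assms by (simp add: Cons_in_BH_verts)
  moreover have "p # x \<in> A \<union> B \<union> W" if "x \<in> BH_verts k" "p \<in> {twin_base b, twin_base b + 2}" for p x
    unfolding assms using that by (auto simp: Cons_in_BH_verts twin_base_def split: if_splits)
  ultimately show ?thesis unfolding touched_def swallowed_def by blast
qed

lemma C4_substructure_cut_card:
  assumes k: "k \<ge> 1" and fin: "finite F" and cut: "substructure_cut (BH (Suc k)) (cycle_graph 4) F"
  shows "Suc k \<le> card F"
proof (rule ccontr)
  assume "\<not> Suc k \<le> card F"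
  then have F: "card F \<le> k" by simp
  let ?G = "BH (Suc k)"
  have S: "connected_subgraph S ?G" "\<exists>T. connected_subgraph T (cycle_graph 4) \<and> digraph_iso (with_proj S) (with_proj T)"
    if "S \<in> F" for S
    using cut that by (auto simp: substructure_cut_def subgraph_cut_def)
  have Sfin: "finite (pverts S)" and Spar: "card {v \<in> pverts S. even (hd v) = b} \<le> 2" if "S \<in> F" for S b
    using S[OF that] C4_substructure_parity_card by blast+
  have Swf: "wf_digraph (with_proj S)" and Scon: "Digraph_Component.connected (with_proj S)"
    and Sv: "pverts S \<subseteq> BH_verts (Suc k)" and Sa: "parcs S \<subseteq> parcs ?G" if "S \<in> F" for S
    using S(1)[OF that] by (auto simp: connected_subgraph_def pverts_BH elim!: subgraphE)
  define W where "W = (\<Union>S\<in>F. pverts S)"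
  define U where "U = BH_verts (Suc k) - W"
  have W: "W \<subseteq> BH_verts (Suc k)" using Sv by (auto simp: W_def)
  have finW: "finite W" using fin Sfin by (simp add: W_def)
  have Wpar: "card {v \<in> W. even (hd v) = b} \<le> 2 * k" for b
  proof -
    have "{v \<in> W. even (hd v) = b} = (\<Union>S\<in>F. {v \<in> pverts S. even (hd v) = b})" by (auto simp: W_def)
    then have "card {v \<in> W. even (hd v) = b} \<le> (\<Sum>S\<in>F. card {v \<in> pverts S. even (hd v) = b})"
      by (simp only: card_UN_le[OF fin])
    also have "\<dots> \<le> (\<Sum>S\<in>F. 2)" by (intro sum_mono Spar)
    also have "\<dots> \<le> 2 * k" using F by simp
    finally show ?thesis .
  qed
  have Wsplit: "card W = card {v \<in> W. even (hd v) = True} + card {v \<in> W. even (hd v) = False}"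
    using finW by (subst card_Un_disjoint[symmetric]) (auto intro!: arg_cong[where f = card])
  \<comment> \<open>At least \<open>4 * (4 ^ k - k)\<close>, hence 8, vertices survive, so the
    remainder is not trivial and must be disconnected.\<close>
  have "card U = 4 ^ Suc k - card W"
    unfolding U_def using W finW by (simp add: card_Diff_subset card_BH_verts)
  moreover have "card W \<le> 4 * k" using Wsplit Wpar[of True] Wpar[of False] by linarith
  ultimately have U2: "card U \<ge> 2" using add_two_le_four_power[OF k] by simp
  then have "U \<noteq> {}" by auto
  let ?R = "delete_verts ?G W"
  have R: "verts ?R = U" "tail ?R = fst" "head ?R = snd"
    by (simp_all add: delete_verts_simps pverts_BH U_def)
  have "\<not> Digraph_Component.connected ?R \<or> card (verts ?R) = 1"
    using cut unfolding substructure_cut_def subgraph_cut_def Let_def trivial_graph_def W_def by (elim conjE)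
  then have "\<not> Digraph_Component.connected ?R" using U2 R by simp
  then have "\<exists>A. A \<noteq> {} \<and> A \<subset> U \<and> (\<forall>e\<in>arcs ?R. (fst e \<in> A) = (snd e \<in> A))"
    unfolding connected_iff_crossing_arc[OF wf_delete_verts] R using \<open>U \<noteq> {}\<close> by blast
  then obtain A where A: "A \<noteq> {}" "A \<subset> U"
    and nc: "\<And>e. e \<in> arcs ?R \<Longrightarrow> (fst e \<in> A) = (snd e \<in> A)" by blast
  define B where "B = U - A"
  have AB: "A \<subseteq> BH_verts (Suc k)" "B \<subseteq> BH_verts (Suc k)" "B \<noteq> {}" "A \<union> B \<union> W = BH_verts (Suc k)"
    using A W by (auto simp: B_def U_def)
  have no_arc: "v \<notin> B" if "(u, v) \<in> parcs ?G" "u \<in> A" for u v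
  proof
    assume "v \<in> B"
    then have "(u, v) \<in> arcs (delete_verts ?G W)"
      using that A by (auto simp: delete_verts_simps pverts_BH B_def U_def)
    from nc[OF this] \<open>v \<in> B\<close> that show False by (auto simp: B_def)
  qed
  have sep: "separated k (touched True A) (touched False B)" "separated k (touched True B) (touched False A)"
    using separated_touched[OF AB(1,2)] separated_touched[OF AB(2,1)] no_arc BH_arc_sym by blast+
  note cover = touched_cover[OF AB(4)]
  have touched_ne: "touched True C \<union> touched False C \<noteq> {}" if "C \<subseteq> BH_verts (Suc k)" "C \<noteq> {}" for C
  proof -
    from that obtain v where "v \<in> C" "v \<in> BH_verts (Suc k)" by blast
    then show ?thesis by (auto elim!: BH_verts_SucE simp: touched_def twin_base_def)
  qed
  have sw: "swallowed b W \<subseteq> BH_verts k" "card (swallowed b W) \<le> k" for b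
    using cover[of b] swallowed_card(1)[OF W, of b] Wpar[of b] by auto
  have tight: "card (swallowed True W) = k" "card (swallowed False W) = k"
    and alt: "card (touched True A) = 1 \<and> card (touched False A) = 1 \<or>
      card (touched True B) = 1 \<and> card (touched False B) = 1"
    using separation_tight[OF sw(1) sw(1) cover cover sep sw(2) sw(2) touched_ne[OF AB(1) A(1)] touched_ne[OF AB(2,3)]]
    by auto
  have no_edge: "bump i a \<notin> swallowed False W" if a: "a \<in> swallowed True W" and i: "i \<le> k" for a i
    using alt
  proof (elim disjE conjE)
    assume "card (touched True A) = 1" "card (touched False A) = 1"
    then obtain x y where xy: "touched True A = {x}" "touched False A = {y}" by (metis card_1_singletonE)
    show ?thesis
      by (rule single_edge_side[of "touched True B" k "touched False B" "swallowed True W" "swallowed False W" x y])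
        (use xy sep cover[of True] cover[of False] sw tight a i in auto)
  next
    assume "card (touched True B) = 1" "card (touched False B) = 1"
    then obtain x y where xy: "touched True B = {x}" "touched False B = {y}" by (metis card_1_singletonE)
    show ?thesis
      by (rule single_edge_side[of "touched True A" k "touched False A" "swallowed True W" "swallowed False W" x y])
        (use xy sep cover[of True] cover[of False] sw tight a i in auto)
  qed
  have tight': "card (swallowed b W) = k" for b using tight by (cases b) simp_all
  \<comment> \<open>The \<open>k\<close> swallowed classes of each parity already use up the bound
    \<open>2 * k\<close>, so \<open>W\<close> consists of whole classes.\<close>
  have full: "card {v \<in> W. even (hd v) = b} = 2 * k" for b
    using swallowed_card(1)[OF W, of b] Wpar[of b] tight'[of b] by linarith
  have swallow: "tl v \<in> swallowed b W" if "v \<in> W" "even (hd v) = b" for v b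
    by (rule swallowed_card(2)[OF W _ that]) (simp only: tight' full)
  \<comment> \<open>Single vertices would cover at most \<open>k\<close> of the \<open>4 * k\<close>
    elements of \<open>W\<close>. So some removed subgraph has an edge, and its ends lie in
    swallowed classes, against \<open>no_edge\<close>.\<close>
  have "\<exists>S\<in>F. \<not> card (pverts S) \<le> 1"
  proof (rule ccontr)
    assume "\<not> (\<exists>S\<in>F. \<not> card (pverts S) \<le> 1)"
    then have "(\<Sum>S\<in>F. card (pverts S)) \<le> (\<Sum>S\<in>F. 1)" by (intro sum_mono) auto
    moreover have "card W \<le> (\<Sum>S\<in>F. card (pverts S))" unfolding W_def by (rule card_UN_le[OF fin])
    ultimately show False using full[of True] full[of False] Wsplit F k by simp
  qed
  then obtain S where S: "S \<in> F" "\<not> card (pverts S) \<le> 1" by blast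
  then obtain u v where "u \<in> pverts S" "v \<in> pverts S" "u \<noteq> v"
    using Sfin[OF S(1)] by (metis card_le_Suc0_iff_eq One_nat_def)
  then obtain w where "w \<in> pverts S" "(u, w) \<in> parcs S \<or> (w, u) \<in> parcs S"
    using connected_has_arc[OF Swf Scon, of S u v] S by metis
  then have uw: "u \<in> W" "w \<in> W" "(u, w) \<in> parcs ?G"
    using S(1) \<open>u \<in> pverts S\<close> Sa[OF S(1)] BH_arc_sym unfolding W_def by blast+
  obtain p x where u: "u = p # x" using BH_arc_in_verts(1)[OF uw(3)] by (rule BH_verts_SucE)
  obtain q y where w: "w = q # y" using BH_arc_in_verts(2)[OF uw(3)] by (rule BH_verts_SucE)
  from uw(3) consider i where "even p" "odd q" "i \<le> k" "y = bump i x" | i where "odd p" "even q" "i \<le> k" "x = bump i y"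
    unfolding u w BH_arc_iff by blast
  then show False
  proof cases
    case 1
    then show False using no_edge[of x i] swallow[OF uw(1), of True] swallow[OF uw(2), of False] u w by simp
  next
    case 2
    then show False using no_edge[of y i] swallow[OF uw(2), of True] swallow[OF uw(1), of False] u w by simp
  qed
qed

subsection \<open>Upper bound\<close>

definition twin_path :: "int list \<Rightarrow> int list pair_pre_digraph" where
  "twin_path x = \<lparr> pverts = {1 # x, 2 # x, 3 # x},
     parcs = {(1 # x, 2 # x), (2 # x, 1 # x), (2 # x, 3 # x), (3 # x, 2 # x)} \<rparr>"

text \<open>Numbered from 1, so that the first coordinate maps \<open>twin_path x\<close> onto
  it.\<close>

definition path3 :: "nat pair_pre_digraph" where
  "path3 = \<lparr> pverts = {1, 2, 3}, parcs = {(1, 2), (2, 1), (2, 3), (3, 2)} \<rparr>"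

text \<open>Serves \<open>twin_path\<close> and \<open>path3\<close> alike: a nonempty proper subset
  of the vertices separates \<open>a\<close> from \<open>b\<close> or \<open>b\<close> from
  \<open>c\<close>.\<close>

lemma connected_path3:
  fixes G :: "'a pair_pre_digraph"
  assumes "G = \<lparr> pverts = {a, b, c}, parcs = {(a, b), (b, a), (b, c), (c, b)} \<rparr>"
  shows "wf_digraph (with_proj G)" "symmetric (with_proj G)" "Digraph_Component.connected (with_proj G)"
proof -
  show wf: "wf_digraph (with_proj G)" by unfold_locales (auto simp: assms)
  show "symmetric (with_proj G)" by (auto simp: symmetric_def assms intro!: symI)
  show "Digraph_Component.connected (with_proj G)"
    unfolding connected_iff_crossing_arc[OF wf]
  proof (intro conjI allI impI)
    fix A assume "A \<noteq> {} \<and> A \<subset> verts (with_proj G)"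
    then have "(a \<in> A) \<noteq> (b \<in> A) \<or> (b \<in> A) \<noteq> (c \<in> A)" by (auto simp: assms)
    then show "\<exists>e\<in>arcs (with_proj G). (tail (with_proj G) e \<in> A) \<noteq> (head (with_proj G) e \<in> A)"
      by (auto simp: assms)
  qed (simp add: assms)
qed

lemma path3_in_C4: "connected_subgraph path3 (cycle_graph 4)"
  unfolding connected_subgraph_def
proof (intro conjI connected_path3(2,3)[OF path3_def])
  show "subgraph (with_proj path3) (with_proj (cycle_graph 4))"
  proof (rule subgraphI)
    show "wf_digraph (with_proj (cycle_graph 4))" by unfold_locales (auto simp: cycle_graph_def)
    show "wf_digraph (with_proj path3)" by (rule connected_path3(1)[OF path3_def])
  qed (auto simp: path3_def cycle_graph_def compatible_def)
qed

lemma twin_path_in_BH: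
  assumes "x \<in> BH_verts k"
  shows "connected_subgraph (twin_path x) (BH (Suc k))"
  unfolding connected_subgraph_def
proof (intro conjI connected_path3(2,3)[OF twin_path_def])
  have "length x = k" using assms by (simp add: BH_verts_def)
  then have "\<exists>i\<le>k. x = bump i x" by (auto simp: bump_def list_update_beyond)
  then show "subgraph (with_proj (twin_path x)) (with_proj (BH (Suc k)))"
    using assms by (intro subgraphI connected_path3(1)[OF twin_path_def] wf_BH)
      (auto simp: twin_path_def BH_arc_iff pverts_BH Cons_in_BH_verts compatible_def)
qed

lemma twin_path_iso: "digraph_iso (with_proj (twin_path x)) (with_proj path3)"
proof -
  define f :: "int list \<Rightarrow> nat" where "f v = nat (hd v)" for v
  define h where "h = \<lparr> iso_verts = f, iso_arcs = map_prod f f, iso_head = snd, iso_tail = fst \<rparr>"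
  have "pre_digraph.digraph_isomorphism (with_proj (twin_path x)) h"
    unfolding pre_digraph.digraph_isomorphism_def using connected_path3(1)[OF twin_path_def]
    by (auto simp: h_def f_def twin_path_def inj_on_def)
  moreover have "with_proj path3 = app_iso h (with_proj (twin_path x))"
    by (simp add: app_iso_def h_def f_def twin_path_def path3_def with_proj_def)
  ultimately show ?thesis by (auto simp: digraph_iso_def)
qed

lemma C4_substructure_cut_exists:
  "\<exists>F. finite F \<and> substructure_cut (BH (Suc k)) (cycle_graph 4) F \<and> card F = Suc k"
proof -
  define z :: "int list" where "z = replicate k 0"
  have z: "z \<in> BH_verts k" by (auto simp: z_def BH_verts_def)
  define F where "F = (\<lambda>i. twin_path (bump i z)) ` {..k}"
  have bz: "bump i z \<in> BH_verts k" for i by (rule bump_in_BH_verts[OF z])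
  have inj: "inj_on (\<lambda>i. twin_path (bump i z)) {..k}"
  proof (rule inj_onI)
    fix i j assume "i \<in> {..k}" "j \<in> {..k}" "twin_path (bump i z) = twin_path (bump j z)"
    then have "pverts (twin_path (bump i z)) = pverts (twin_path (bump j z))" by simp
    then have "bump i z = bump j z" by (auto simp: twin_path_def)
    then show "i = j" using inj_on_bump[OF z] \<open>i \<in> {..k}\<close> \<open>j \<in> {..k}\<close> by (auto dest: inj_onD)
  qed
  let ?W = "\<Union>S\<in>F. pverts S"
  let ?R = "delete_verts (BH (Suc k)) ?W"
  have zR: "0 # z \<in> verts ?R"
    using z by (auto simp: delete_verts_simps pverts_BH Cons_in_BH_verts F_def twin_path_def)
  have isolated: "(0 # z, v) \<notin> arcs ?R \<and> (v, 0 # z) \<notin> arcs ?R" for v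
  proof -
    \<comment> \<open>A neighbour of \<open>0 # z\<close> is an odd vertex of some class
      \<open>bump i z\<close>, and \<open>twin_path\<close> contains both odd vertices of its class;
      \<open>2 # x\<close> only links them.\<close>
    have "v \<in> ?W" if arc: "(0 # z, v) \<in> parcs (BH (Suc k))" for v
    proof -
      obtain q y where v: "v = q # y" "q \<in> {0, 1, 2, 3}"
        using BH_arc_in_verts(2)[OF arc] by (rule BH_verts_SucE)
      with arc obtain i where "i \<le> k" "y = bump i z" "odd q" by (auto simp: BH_arc_iff)
      with v show ?thesis by (auto simp: F_def twin_path_def)
    qed
    then show ?thesis using BH_arc_sym by (auto simp: delete_verts_simps)
  qed
  have "\<not> Digraph_Component.connected ?R \<or> trivial_graph ?R"
  \<comment> \<open>For \<open>k = 0\<close> only \<open>0 # z\<close> is left and the remainder is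
    trivial; if anything else survives, \<open>0 # z\<close> is isolated from it.\<close>
  proof (cases "verts ?R = {0 # z}")
    case True
    then show ?thesis by (simp add: trivial_graph_def)
  next
    case False
    then have "{0 # z} \<subset> verts ?R" using zR by blast
    moreover have "(tail ?R e \<in> {0 # z}) = (head ?R e \<in> {0 # z})" if "e \<in> arcs ?R" for e
      using isolated that by (cases e) (auto simp: delete_verts_simps(3,4))
    ultimately have "\<not> Digraph_Component.connected ?R"
      unfolding connected_iff_crossing_arc[OF wf_delete_verts] by blast
    then show ?thesis ..
  qed
  then have "substructure_cut (BH (Suc k)) (cycle_graph 4) F"
    unfolding substructure_cut_def subgraph_cut_def Let_def
    using twin_path_in_BH[OF bz] twin_path_iso path3_in_C4 by (auto simp: F_def)
  moreover have "card F = Suc k" using card_image[OF inj] by (simp add: F_def)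
  ultimately show ?thesis by (auto simp: F_def)
qed

theorem theorem6:
  fixes n :: nat
  assumes "n \<ge> 2"
  shows "\<kappa>\<^sup>s (BH n) (cycle_graph 4) = n"
proof -
  obtain k where n: "n = Suc k" "k \<ge> 1" using assms by (cases n) auto
  show ?thesis
    unfolding substructure_connectivity_def n(1)
    by (rule Least_equality) (use C4_substructure_cut_exists C4_substructure_cut_card[OF n(2)] in auto)
qed

end
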